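(* Let $\mathrm{a}_{n,k}^{\mathrm{pk}}(213,312)$ denote the number of permutations of $\{1,\dots,n\}$ that avoid both $213$ and $312$ and have exactly $k$ peaks. Then $$\mathrm{a}_{n,k}^{\mathrm{pk}}(213,312)=\begin{cases}2,&k=0;\\ 2^{n-1}-2,&k=1;\\ 0,&\text{otherwise}.\end{cases}$$
   Context: $\mathcal{S}_n$ is the set of permutations $\pi=\pi_1\cdots\pi_n$ of $\{1,\dots,n\}$. For $\rho\in\mathcal{S}_m$, $\pi\in\mathcal{S}_n$ contains $\rho$ if there are indices $1\le i_1<\cdots<i_m\le n$ such that $\pi_{i_a}<\pi_{i_b}$ if and only if $\rho_a<\rho_b$; otherwise $\pi$ avoids $\rho$. The number of peaks is $\mathrm{pk}(\pi)=|\{i:\pi_i<\pi_{i+1}\text{ and }\pi_{i+1}>\pi_{i+2}\}|$, where $1\le i\le n-2$.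
   Formalization: The formula is proved for n ≥ 2 only; for n = 0 and n = 1 it fails, since there is exactly one permutation and it has no peaks, so the count for k = 0 is 1 and not 2. *)

theory Defs
  imports "HOL-Combinatorics.Combinatorics"
begin

(* Permutations of {1..n} are written in one-line notation, as elements of
   permutations_of_set {1..n} :: nat list set. List positions count from 0, so
   the entry pi_i of a permutation is \<pi> ! (i - 1). *)

definition contains_pattern :: "nat list \<Rightarrow> nat list \<Rightarrow> bool" where
  "contains_pattern \<pi> \<rho> \<longleftrightarrow>
     (\<exists>f :: nat \<Rightarrow> nat. strict_mono_on {..<length \<rho>} f \<and>
        f ` {..<length \<rho>} \<subseteq> {..<length \<pi>} \<and>
        (\<forall>a<length \<rho>. \<forall>b<length \<rho>. \<pi> ! f a < \<pi> ! f b \<longleftrightarrow> \<rho> ! a < \<rho> ! b))"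

definition avoids :: "nat list \<Rightarrow> nat list \<Rightarrow> bool" where
  "avoids \<pi> \<rho> \<longleftrightarrow> \<not> contains_pattern \<pi> \<rho>"

definition pk :: "nat list \<Rightarrow> nat" where
  "pk \<pi> = card {i. i + 2 < length \<pi> \<and> \<pi> ! i < \<pi> ! (i + 1) \<and> \<pi> ! (i + 1) > \<pi> ! (i + 2)}"

definition a_pk :: "nat list set \<Rightarrow> nat \<Rightarrow> nat \<Rightarrow> nat" where
  "a_pk P n k = card {\<pi> \<in> permutations_of_set {1..n}. (\<forall>\<rho>\<in>P. avoids \<pi> \<rho>) \<and> pk \<pi> = k}"

end

(* A permutation avoids 213 and 312 iff no entry is smaller than both some entry to its left and
   some entry to its right, that is, iff it increases up to the maximum n and decreases afterwards.
   Such a permutation is determined by the set S of entries left of n, which may be any subset of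
   {1..<n}. Its only possible peak is n, and n is a peak unless it stands at one of the two ends,
   that is, unless S is empty or all of {1..<n}. *)

theory Submission
  imports Defs
begin

definition valley_free :: "nat list \<Rightarrow> bool" where
  "valley_free xs \<longleftrightarrow>
     (\<forall>a b c. a < b \<longrightarrow> b < c \<longrightarrow> c < length xs \<longrightarrow> \<not> (xs ! b < xs ! a \<and> xs ! b < xs ! c))"

definition unimodal_list :: "nat \<Rightarrow> nat set \<Rightarrow> nat list" where
  "unimodal_list n S = sorted_list_of_set S @ n # rev (sorted_list_of_set ({1..<n} - S))"

lemma contains_pattern_3I:
  assumes "a < b" "b < c" "c < length xs"
    and "\<And>i j. i < 3 \<Longrightarrow> j < 3 \<Longrightarrow>
           xs ! ([a, b, c] ! i) < xs ! ([a, b, c] ! j) \<longleftrightarrow> [p, q, r] ! i < [p, q, r] ! j"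
  shows "contains_pattern xs [p, q, r]"
  unfolding contains_pattern_def
proof (intro exI conjI)
  show "strict_mono_on {..<length [p, q, r]} ((!) [a, b, c])"
    using assms(1,2) by (auto simp: strict_mono_on_def less_Suc_eq numeral_eq_Suc)
  show "(!) [a, b, c] ` {..<length [p, q, r]} \<subseteq> {..<length xs}"
    using assms(1-3) by (auto simp: less_Suc_eq numeral_eq_Suc)
  show "\<forall>i<length [p, q, r]. \<forall>j<length [p, q, r].
          xs ! ([a, b, c] ! i) < xs ! ([a, b, c] ! j) \<longleftrightarrow> [p, q, r] ! i < [p, q, r] ! j"
    using assms(4) by (simp add: numeral_eq_Suc)
qed

text \<open>Only the comparisons of the middle entry with its two neighbours in the occurrence are
  kept: for 213 and for 312 alike they already exhibit a valley.\<close>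

lemma contains_pattern_3E:
  assumes "contains_pattern xs [p, q, r]"
  obtains a b c where "a < b" "b < c" "c < length xs"
    "xs ! b < xs ! a \<longleftrightarrow> q < p" "xs ! b < xs ! c \<longleftrightarrow> q < r"
proof -
  obtain f where f: "strict_mono_on {..<length [p, q, r]} f"
      "f ` {..<length [p, q, r]} \<subseteq> {..<length xs}"
      "\<And>i j. i < 3 \<Longrightarrow> j < 3 \<Longrightarrow> xs ! f i < xs ! f j \<longleftrightarrow> [p, q, r] ! i < [p, q, r] ! j"
    using assms unfolding contains_pattern_def by (auto simp: numeral_eq_Suc)
  show thesis
  proof (rule that)
    show "f 0 < f 1" "f 1 < f 2"
      by (rule strict_mono_onD[OF f(1)]; simp)+
    show "f 2 < length xs" using f(2) by (simp add: image_subset_iff)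
    show "xs ! f 1 < xs ! f 0 \<longleftrightarrow> q < p" "xs ! f 1 < xs ! f 2 \<longleftrightarrow> q < r"
      using f(3)[of 1 0] f(3)[of 1 2] by simp_all
  qed
qed

text \<open>The two patterns differ only in the order of their outer entries. Distinctness makes the
  outer entries of a valley unequal, so each valley is an occurrence of exactly one of them.\<close>

lemma avoids_213_312_iff:
  assumes "distinct xs"
  shows "avoids xs [2,1,3] \<and> avoids xs [3,1,2] \<longleftrightarrow> valley_free xs"
proof
  assume av: "avoids xs [2,1,3] \<and> avoids xs [3,1,2]"
  show "valley_free xs"
    unfolding valley_free_def
  proof (intro allI impI notI)
    fix a b c
    assume abc: "a < b" "b < c" "c < length xs" and v: "xs ! b < xs ! a \<and> xs ! b < xs ! c"
    have "xs ! a \<noteq> xs ! c"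
      using assms abc by (simp add: nth_eq_iff_index_eq)
    then consider "xs ! a < xs ! c" | "xs ! c < xs ! a" by linarith
    then show False
    proof cases
      case 1
      have "contains_pattern xs [2,1,3]"
        by (rule contains_pattern_3I[OF abc]) (use 1 v in \<open>auto simp: less_Suc_eq numeral_eq_Suc\<close>)
      then show False using av by (simp add: avoids_def)
    next
      case 2
      have "contains_pattern xs [3,1,2]"
        by (rule contains_pattern_3I[OF abc]) (use 2 v in \<open>auto simp: less_Suc_eq numeral_eq_Suc\<close>)
      then show False using av by (simp add: avoids_def)
    qed
  qed
next
  assume "valley_free xs"
  then show "avoids xs [2,1,3] \<and> avoids xs [3,1,2]"
    unfolding avoids_def valley_free_def by (auto elim!: contains_pattern_3E)
qed

text \<open>Both positions lie in the prefix \<open>as @ [m]\<close>; the bound on \<open>j\<close>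
  is weak so that the position of \<open>m\<close> itself is covered.\<close>

lemma unimodal_nth_less:
  assumes "sorted_wrt (<) (as @ [m])" "i < j" "j \<le> length as"
  shows "(as @ m # bs) ! i < (as @ m # bs) ! j"
  using sorted_wrt_nth_less[OF assms(1,2)] assms(2,3)
  by (auto simp: nth_append split: if_splits)

lemma unimodal_nth_greater:
  assumes "sorted_wrt (>) (m # bs)" "i < j" "length as \<le> i" "j < length (as @ m # bs)"
  shows "(as @ m # bs) ! i > (as @ m # bs) ! j"
  using sorted_wrt_nth_less[OF assms(1), of "i - length as" "j - length as"] assms(2-4)
  by (simp add: nth_append)

text \<open>A middle position up to that of \<open>m\<close> has only smaller entries before it, and
  one beyond \<open>m\<close> has only smaller entries after it, so neither can be the bottom of a
  valley.\<close>

lemma valley_free_unimodal: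
  assumes "sorted_wrt (<) (as @ [m])" "sorted_wrt (>) (m # bs)"
  shows "valley_free (as @ m # bs)"
  unfolding valley_free_def
proof (intro allI impI)
  fix a b c
  assume abc: "a < b" "b < c" "c < length (as @ m # bs)"
  show "\<not> ((as @ m # bs) ! b < (as @ m # bs) ! a \<and> (as @ m # bs) ! b < (as @ m # bs) ! c)"
  proof (cases "b \<le> length as")
    case True
    then show ?thesis using unimodal_nth_less[OF assms(1) abc(1), of bs] by simp
  next
    case False
    then show ?thesis using unimodal_nth_greater[OF assms(2) abc(2) _ abc(3)] by simp
  qed
qed

lemma pk_unimodal:
  assumes "sorted_wrt (<) (as @ [m])" "sorted_wrt (>) (m # bs)"
  shows "pk (as @ m # bs) = (if as = [] \<or> bs = [] then 0 else 1)"
proof -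
  let ?xs = "as @ m # bs"
  \<comment> \<open>A peak is indexed by its left neighbour, so a peak at \<open>m\<close>, which
    has index \<open>length as\<close>, is counted at \<open>i + 1 = length as\<close>. For smaller
    \<open>i\<close> the second step still ascends; for larger \<open>i\<close> the first step
    already descends.\<close>
  have "i + 2 < length ?xs \<and> ?xs ! i < ?xs ! (i + 1) \<and> ?xs ! (i + 1) > ?xs ! (i + 2)
        \<longleftrightarrow> i + 1 = length as \<and> bs \<noteq> []" for i
  proof -
    consider "i + 2 \<le> length as" | "length as \<le> i" | "i + 1 = length as" by linarith
    then show ?thesis
    proof cases
      case 1
      then show ?thesis using unimodal_nth_less[OF assms(1), of "i + 1" "i + 2" bs] by simp
    next
      case 2
      then show ?thesis using unimodal_nth_greater[OF assms(2), of i "i + 1" as] by fastforce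
    next
      case 3
      then show ?thesis
        using unimodal_nth_less[OF assms(1), of i "i + 1" bs]
          unimodal_nth_greater[OF assms(2), of "i + 1" "i + 2" as]
        by (auto simp: Suc_le_eq simp flip: length_greater_0_conv)
    qed
  qed
  then have "pk ?xs = card {i. i + 1 = length as \<and> bs \<noteq> []}"
    unfolding pk_def by simp
  also have "{i. i + 1 = length as \<and> bs \<noteq> []} =
      (if as = [] \<or> bs = [] then {} else {length as - 1})"
    by (cases as) auto
  finally show ?thesis by simp
qed

text \<open>A descent within \<open>as\<close> would form a valley with \<open>m\<close> as its
  right end, and an ascent within \<open>bs\<close> one with \<open>m\<close> as its left
  end.\<close>

lemma valley_free_around_maximum:
  assumes "valley_free (as @ m # bs)" "distinct (as @ m # bs)" "\<And>x. x \<in> set (as @ bs) \<Longrightarrow> x < m"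
  shows "sorted_wrt (<) as" "sorted_wrt (>) bs"
proof -
  let ?xs = "as @ m # bs"
  have nv: "\<not> (?xs ! b < ?xs ! a \<and> ?xs ! b < ?xs ! c)"
    if "a < b" "b < c" "c < length ?xs" for a b c
    using assms(1) that unfolding valley_free_def by blast
  show "sorted_wrt (<) as"
    unfolding sorted_wrt_iff_nth_less
  proof (intro allI impI)
    fix i j assume ij: "i < j" "j < length as"
    have "as ! i \<noteq> as ! j" using assms(2) ij by (simp add: nth_eq_iff_index_eq)
    moreover have "as ! j < m" using assms(3) ij by simp
    ultimately show "as ! i < as ! j"
      using nv[of i j "length as"] ij by (simp add: nth_append)
  qed
  show "sorted_wrt (>) bs"
    unfolding sorted_wrt_iff_nth_less
  proof (intro allI impI)
    fix i j assume ij: "i < j" "j < length bs"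
    have "bs ! i \<noteq> bs ! j" using assms(2) ij by (simp add: nth_eq_iff_index_eq)
    moreover have "bs ! i < m" using assms(3) ij by simp
    ultimately show "bs ! j < bs ! i"
      using nv[of "length as" "length as + Suc i" "length as + Suc j"] ij by (simp add: nth_append)
  qed
qed

lemma sorted_unimodal_list:
  fixes n :: nat
  assumes "S \<subseteq> {1..<n}"
  shows "sorted_wrt (<) (sorted_list_of_set S @ [n])"
    and "sorted_wrt (>) (n # rev (sorted_list_of_set ({1..<n} - S)))"
proof -
  \<comment> \<open>The entries of \<open>sorted_list_of_set S\<close> are those of \<open>S\<close>
    only when \<open>S\<close> is finite.\<close>
  have "finite S" using finite_subset[OF assms] by simp
  then show "sorted_wrt (<) (sorted_list_of_set S @ [n])"
    using assms by (auto simp: sorted_wrt_append)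
  show "sorted_wrt (>) (n # rev (sorted_list_of_set ({1..<n} - S)))"
    by (simp add: sorted_wrt_rev)
qed

lemma inj_on_unimodal_list: "inj_on (unimodal_list n) (Pow {1..<n})"
proof (rule inj_onI)
  fix S T assume ST: "S \<in> Pow {1..<n}" "T \<in> Pow {1..<n}"
    and eq: "unimodal_list n S = unimodal_list n T"
  have fin: "finite S" "finite T" using ST by (auto intro: finite_subset)
  \<comment> \<open>The set is recovered as the entries before the first \<open>n\<close>; since
    \<open>n\<close> is not in \<open>U\<close>, \<open>takeWhile\<close> stops exactly at the
    maximum.\<close>
  have left: "takeWhile (\<lambda>x. x \<noteq> n) (unimodal_list n U) = sorted_list_of_set U"
    if "U \<in> Pow {1..<n}" for U
    using that finite_subset[of U "{1..<n}"] unfolding unimodal_list_def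
    by (subst takeWhile_append2) auto
  have "sorted_list_of_set S = sorted_list_of_set T"
    using left[OF ST(1)] left[OF ST(2)] eq by simp
  then show "S = T"
    using fin by (metis set_sorted_list_of_set)
qed

text \<open>Splitting a list at its maximum \<open>n\<close> gives the preimage
  \<open>set as\<close>. For \<open>n = 0\<close> the claim fails: the only permutation is the empty
  list, whereas \<open>unimodal_list 0 {}\<close> is \<open>[0]\<close>.\<close>

lemma valley_free_permutations_eq:
  assumes "n \<ge> 1"
  shows "{xs \<in> permutations_of_set {1..n}. valley_free xs} = unimodal_list n ` Pow {1..<n}"
proof (intro equalityI subsetI)
  fix xs assume "xs \<in> {xs \<in> permutations_of_set {1..n}. valley_free xs}"
  then have xs: "set xs = {1..n}" "distinct xs" "valley_free xs"
    by (auto simp: permutations_of_set_def)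
  then obtain as bs where split: "xs = as @ n # bs"
    using assms by (metis atLeastAtMost_iff order_refl split_list)
  have un: "set as \<union> set bs = {1..<n}"
  proof -
    have "set as \<union> set bs = set xs - {n}" using xs(2) split by auto
    also have "\<dots> = {1..<n}" unfolding xs(1) by auto
    finally show ?thesis .
  qed
  have less: "x < n" if "x \<in> set (as @ bs)" for x
    using that un by auto
  have sorted: "sorted_wrt (<) as" "sorted_wrt (>) bs"
    using valley_free_around_maximum[of as n bs] xs split less by auto
  \<comment> \<open>A strictly monotone list is determined by its set of entries, so both halves can
    be rebuilt from \<open>set as\<close>.\<close>
  have "set bs = {1..<n} - set as" using un xs(2) split by auto
  moreover have "sorted_list_of_set (set as) = as"
    using sorted(1) sorted_list_of_set.idem_if_sorted_distinct strict_sorted_iff by blast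
  moreover have "sorted_list_of_set (set bs) = rev bs"
    using sorted(2) sorted_list_of_set.idem_if_sorted_distinct[of "rev bs"] strict_sorted_iff[of "rev bs"]
    by (simp add: sorted_wrt_rev)
  ultimately have "xs = unimodal_list n (set as)"
    unfolding unimodal_list_def by (simp add: split)
  then show "xs \<in> unimodal_list n ` Pow {1..<n}" using un by auto
next
  fix xs assume "xs \<in> unimodal_list n ` Pow {1..<n}"
  then obtain S where S: "S \<subseteq> {1..<n}" "xs = unimodal_list n S" by auto
  have "finite S" using finite_subset[OF S(1)] by simp
  then have "xs \<in> permutations_of_set {1..n}"
    using S assms unfolding permutations_of_set_def unimodal_list_def by auto
  moreover have "valley_free xs"
    using valley_free_unimodal[OF sorted_unimodal_list[OF S(1)]] S(2)
    by (simp add: unimodal_list_def)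
  ultimately show "xs \<in> {xs \<in> permutations_of_set {1..n}. valley_free xs}" by simp
qed

lemma pk_unimodal_list:
  assumes "S \<subseteq> {1..<n}"
  shows "pk (unimodal_list n S) = (if S \<in> {{}, {1..<n}} then 0 else 1)"
proof -
  have "finite S" using finite_subset[OF assms] by simp
  then have "sorted_list_of_set S = [] \<longleftrightarrow> S = {}"
    "rev (sorted_list_of_set ({1..<n} - S)) = [] \<longleftrightarrow> S = {1..<n}"
    using assms by auto
  then show ?thesis
    unfolding unimodal_list_def pk_unimodal[OF sorted_unimodal_list[OF assms]] by auto
qed

theorem proposition8:
  fixes n k :: nat
  assumes "n \<ge> 2"
  shows "int (a_pk {[2,1,3], [3,1,2]} n k) =
           (if k = 0 then 2 else if k = 1 then 2 ^ (n - 1) - 2 else 0)"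
proof -
  \<comment> \<open>These are the two choices that put \<open>n\<close> at an end of the
    permutation, leaving no peak.\<close>
  let ?E = "{{}, {1..<n}}"
  have "{\<pi> \<in> permutations_of_set {1..n}. (\<forall>\<rho>\<in>{[2,1,3], [3,1,2]}. avoids \<pi> \<rho>) \<and> pk \<pi> = k} =
      {\<pi> \<in> {\<pi> \<in> permutations_of_set {1..n}. valley_free \<pi>}. pk \<pi> = k}"
    using avoids_213_312_iff by (auto dest: permutations_of_setD(2))
  also have "\<dots> = unimodal_list n ` {S \<in> Pow {1..<n}. pk (unimodal_list n S) = k}"
    using valley_free_permutations_eq[of n] assms by auto
  finally have "a_pk {[2,1,3], [3,1,2]} n k = card {S \<in> Pow {1..<n}. pk (unimodal_list n S) = k}"
    unfolding a_pk_def
    by (simp only:) (rule card_image, rule inj_on_subset[OF inj_on_unimodal_list], auto)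
  also have "{S \<in> Pow {1..<n}. pk (unimodal_list n S) = k} =
      (if k = 0 then ?E else if k = 1 then Pow {1..<n} - ?E else {})"
    by (auto simp: pk_unimodal_list split: if_splits)
  finally have card: "a_pk {[2,1,3], [3,1,2]} n k =
      card (if k = 0 then ?E else if k = 1 then Pow {1..<n} - ?E else {})" .
  \<comment> \<open>The two sets differ because \<open>n \<ge> 2\<close> makes
    \<open>{1..<n}\<close> nonempty.\<close>
  have E: "card ?E = 2" using assms by simp
  then have "card (Pow {1..<n} - ?E) = 2 ^ (n - 1) - 2"
    by (subst card_Diff_subset) (auto simp: card_Pow)
  \<comment> \<open>With this bound the truncated subtraction on naturals agrees with the integer
    subtraction in the claim.\<close>
  moreover have "(2::nat) \<le> 2 ^ (n - 1)"
    using assms self_le_power[of "2::nat" "n - 1"] by simp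
  ultimately show ?thesis using card E by simp
qed

end
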